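(* Let $(\mathfrak g,[\cdot,\cdot])$ be a Lie algebra over a field $\mathbb K$ of characteristic zero, let $\pi_+\in\operatorname{End}(\mathfrak g)$ satisfy $$[\pi_+(x),\pi_+(y)]+\pi_+([x,y])=\pi_+([\pi_+(x),y]+[x,\pi_+(y)])\qquad(x,y\in\mathfrak g),$$ put $\pi_-:=\operatorname{id}-\pi_+$ and $v_\pm:=\pi_\pm(v)$ for $v\in\mathfrak g$, and let $x\triangleright y:=-[\pi_+(x),y]$ be the associated post-Lie product on $\mathfrak g$, with associated product $*$ on $\mathcal U(\mathfrak g)$. Then for each $v\in\mathfrak g$ the following factorization holds in (a completion of) $\mathcal U(\mathfrak g)$: $$\exp^*(v)=\exp(v_-)\exp(v_+).$$
   Context: $\mathcal U(\mathfrak g)$ is the universal enveloping algebra of $(\mathfrak g,[\cdot,\cdot])$ with its usual product (written by juxtaposition), unit $\mathbf 1$, counit $\epsilon$, and coproduct $\Delta$, the algebra morphism with $\Delta(x)=x\otimes\mathbf 1+\mathbf 1\otimes x$ for $x\in\mathfrak g$; Sweedler notation $\Delta(A)=A_{(1)}\otimes A_{(2)}$ is used. The product $\triangleright$ on $\mathfrak g$ extends uniquely to a bilinear product on $\mathcal U(\mathfrak g)$ with $\mathbf 1\triangleright A=A$, $A\triangleright\mathbf 1=\epsilon(A)\mathbf 1$, $A\triangleright(BC)=(A_{(1)}\triangleright B)(A_{(2)}\triangleright C)$, and $(xA)\triangleright B=x\triangleright(A\triangleright B)-(x\triangleright A)\triangleright B$ for $x\in\mathfrak g$, $A,B,C\in\mathcal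 U(\mathfrak g)$. In particular $x\triangleright$ acts as a derivation for $x\in\mathfrak g$. The product $A*B:=A_{(1)}(A_{(2)}\triangleright B)$ on $\mathcal U(\mathfrak g)$ is associative with unit $\mathbf 1$. $\exp(v)=\sum_{n\ge0}v^n/n!$ is the exponential for the usual product and $\exp^*(v)=\sum_{n\ge0}v^{*n}/n!$ is the exponential for $*$, where $v^{*n}$ is the $n$-fold $*$-product. Exponentials live in suitable completions. Identities are read formally: replacing $v$ by $tv$ with a formal parameter $t$, and extending all operations $t$-linearly, they are identities in $\mathcal U(\mathfrak g)[[t]]$. *)

theory Defs
  imports
    Complex_Main
    "HOL-Algebra.QuotRing"
    "HOL-Algebra.Module"
    "HOL-Library.Poly_Mapping"
begin

section \<open>Lie algebras\<close>

locale lie_algebra = vector_space scale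
  for scale :: "'k::field \<Rightarrow> 'g::ab_group_add \<Rightarrow> 'g" +
  fixes bracket :: "'g \<Rightarrow> 'g \<Rightarrow> 'g"
  assumes bracket_add_left: "bracket (x + y) z = bracket x z + bracket y z"
    and bracket_add_right: "bracket x (y + z) = bracket x y + bracket x z"
    and bracket_scale_left: "bracket (scale c x) y = scale c (bracket x y)"
    and bracket_scale_right: "bracket x (scale c y) = scale c (bracket x y)"
    and bracket_self: "bracket x x = 0"
    and jacobi: "bracket x (bracket y z) + bracket y (bracket z x) + bracket z (bracket x y) = 0"


section \<open>Associative unital algebras\<close>

text \<open>
  The scalar field is a type. An algebra over it is a record of type \<^typ>\<open>('k, 'a) module\<close>, that
  is, a ring with carrier together with a scalar multiplication. The library's algebra locale is not
  used because it requires commutativity.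
\<close>

definition base_field :: "('k::field, 'k) module" where
  "base_field = \<lparr>carrier = UNIV, monoid.mult = (*), one = 1, zero = 0, add = (+), smult = (*)\<rparr>"

definition alg_hom :: "('k, 'a) module \<Rightarrow> ('k, 'b) module \<Rightarrow> ('a \<Rightarrow> 'b) set" where
  "alg_hom A B =
    {f \<in> ring_hom A B. \<forall>c. \<forall>a\<in>carrier A. f (c \<odot>\<^bsub>A\<^esub> a) = c \<odot>\<^bsub>B\<^esub> f a}"

text \<open>The quotient ring \<^term>\<open>A Quot I\<close> with the induced scalar multiplication on cosets.\<close>

definition quot_algebra :: "('k, 'a) module \<Rightarrow> 'a set \<Rightarrow> ('k, 'a set) module" where
  "quot_algebra A I = ring.extend (A Quot I)
    (module.fields (\<lambda>c X. \<Union>a\<in>X. I +>\<^bsub>A\<^esub> (c \<odot>\<^bsub>A\<^esub> a)))"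


section \<open>The universal enveloping algebra\<close>

text \<open>
  Words form the free monoid. Its operation is written additively because the convolution product of
  \<^typ>\<open>'a \<Rightarrow>\<^sub>0 'k\<close> expects the monoid of exponents in additive notation.
\<close>

datatype 'a word = Word (letters: "'a list")

instantiation word :: (type) monoid_add
begin
definition "0 = Word []"
definition "u + v = Word (letters u @ letters v)"
instance by standard (simp_all add: zero_word_def plus_word_def)
end

type_synonym ('k, 'g) free_algebra = "'g word \<Rightarrow>\<^sub>0 'k"

definition free_algebra :: "('k::field, ('k, 'g) free_algebra) module" where
  "free_algebra = \<lparr>carrier = UNIV, monoid.mult = (*), one = 1, zero = 0, add = (+),
    smult = (\<lambda>c. Poly_Mapping.map ((*) c))\<rparr>"

definition letter :: "'g \<Rightarrow> ('k::field, 'g) free_algebra" where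
  "letter x = Poly_Mapping.single (Word [x]) 1"

text \<open>
  The letters of the free algebra are the elements of the underlying set of the Lie algebra. The first
  two families of relations cut it down to the tensor algebra, the third one to the enveloping algebra.
\<close>

definition uea_relations ::
    "('k::field \<Rightarrow> 'g::ab_group_add \<Rightarrow> 'g) \<Rightarrow> ('g \<Rightarrow> 'g \<Rightarrow> 'g) \<Rightarrow> ('k, 'g) free_algebra set" where
  "uea_relations scale bracket =
      {letter (x + y) - (letter x + letter y) | x y. True}
    \<union> {letter (scale c x) - Poly_Mapping.map ((*) c) (letter x) | c x. True}
    \<union> {letter x * letter y - letter y * letter x - letter (bracket x y) | x y. True}"

definition uea_ideal ::
    "('k::field \<Rightarrow> 'g::ab_group_add \<Rightarrow> 'g) \<Rightarrow> ('g \<Rightarrow> 'g \<Rightarrow> 'g) \<Rightarrow> ('k, 'g) free_algebra set" where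
  "uea_ideal scale bracket = Idl\<^bsub>free_algebra\<^esub> (uea_relations scale bracket)"

definition uea ::
    "('k::field \<Rightarrow> 'g::ab_group_add \<Rightarrow> 'g) \<Rightarrow> ('g \<Rightarrow> 'g \<Rightarrow> 'g)
      \<Rightarrow> ('k, ('k, 'g) free_algebra set) module" where
  "uea scale bracket = quot_algebra free_algebra (uea_ideal scale bracket)"

definition uea_incl ::
    "('k::field \<Rightarrow> 'g::ab_group_add \<Rightarrow> 'g) \<Rightarrow> ('g \<Rightarrow> 'g \<Rightarrow> 'g)
      \<Rightarrow> 'g \<Rightarrow> ('k, 'g) free_algebra set" where
  "uea_incl scale bracket x = uea_ideal scale bracket +>\<^bsub>free_algebra\<^esub> letter x"


section \<open>The tensor square of an algebra\<close>

text \<open>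
  The vector space with basis \<^term>\<open>carrier A \<times> carrier A\<close>, multiplied componentwise on basis
  vectors. Dividing by the subspace spanned by the bilinearity relations gives the tensor square, whose
  elements are thus the sets of all their representations as formal linear combinations of pairs.
\<close>

definition pair_algebra :: "('k::field, 'a) module \<Rightarrow> ('k, 'a \<times> 'a \<Rightarrow>\<^sub>0 'k) module" where
  "pair_algebra A =
    \<lparr>carrier = {p. Poly_Mapping.keys p \<subseteq> carrier A \<times> carrier A},
     monoid.mult = (\<lambda>p q. \<Sum>(a, b)\<in>Poly_Mapping.keys p. \<Sum>(c, d)\<in>Poly_Mapping.keys q.
       Poly_Mapping.single (a \<otimes>\<^bsub>A\<^esub> c, b \<otimes>\<^bsub>A\<^esub> d)
         (Poly_Mapping.lookup p (a, b) * Poly_Mapping.lookup q (c, d))),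
     one = Poly_Mapping.single (\<one>\<^bsub>A\<^esub>, \<one>\<^bsub>A\<^esub>) 1, zero = 0, add = (+),
     smult = (\<lambda>c. Poly_Mapping.map ((*) c))\<rparr>"

definition tensor_relations :: "('k::field, 'a) module \<Rightarrow> ('a \<times> 'a \<Rightarrow>\<^sub>0 'k) set" where
  "tensor_relations A = (let e = (\<lambda>a b. Poly_Mapping.single (a, b) 1) in
      {e (a \<oplus>\<^bsub>A\<^esub> a') b - (e a b + e a' b) | a a' b.
        a \<in> carrier A \<and> a' \<in> carrier A \<and> b \<in> carrier A}
    \<union> {e a (b \<oplus>\<^bsub>A\<^esub> b') - (e a b + e a b') | a b b'.
        a \<in> carrier A \<and> b \<in> carrier A \<and> b' \<in> carrier A}
    \<union> {e (c \<odot>\<^bsub>A\<^esub> a) b - Poly_Mapping.map ((*) c) (e a b) | c a b.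
        a \<in> carrier A \<and> b \<in> carrier A}
    \<union> {e a (c \<odot>\<^bsub>A\<^esub> b) - Poly_Mapping.map ((*) c) (e a b) | c a b.
        a \<in> carrier A \<and> b \<in> carrier A})"

definition tensor_kernel :: "('k::field, 'a) module \<Rightarrow> ('a \<times> 'a \<Rightarrow>\<^sub>0 'k) set" where
  "tensor_kernel A = Modules.module.span (\<lambda>c. Poly_Mapping.map ((*) c)) (tensor_relations A)"

definition tensor_square ::
    "('k::field, 'a) module \<Rightarrow> ('k, ('a \<times> 'a \<Rightarrow>\<^sub>0 'k) set) module" where
  "tensor_square A = quot_algebra (pair_algebra A) (tensor_kernel A)"

definition pure_tensor ::
    "('k::field, 'a) module \<Rightarrow> 'a \<Rightarrow> 'a \<Rightarrow> ('a \<times> 'a \<Rightarrow>\<^sub>0 'k) set" where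
  "pure_tensor A a b = tensor_kernel A +>\<^bsub>pair_algebra A\<^esub> Poly_Mapping.single (a, b) 1"

text \<open>
  Sweedler notation: for a tensor \<open>X = \<Sum>\<^sub>i a\<^sub>i \<otimes> b\<^sub>i\<close> the value \<open>\<Sum>\<^sub>i f a\<^sub>i b\<^sub>i\<close>. For bilinear \<open>f\<close>, the only
  case in which it is used, this does not depend on the chosen representation of \<open>X\<close>.
\<close>

definition sweedler ::
    "('k::field, 'a) module \<Rightarrow> ('a \<Rightarrow> 'a \<Rightarrow> 'a) \<Rightarrow> ('a \<times> 'a \<Rightarrow>\<^sub>0 'k) set \<Rightarrow> 'a" where
  "sweedler A f X = (let p = (SOME p. p \<in> X) in
     \<Oplus>\<^bsub>A\<^esub>ab\<in>Poly_Mapping.keys p. Poly_Mapping.lookup p ab \<odot>\<^bsub>A\<^esub> f (fst ab) (snd ab))"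


section \<open>Coproduct, counit and the extended post-Lie product\<close>

text \<open>
  In this section \<open>U\<close> is an enveloping algebra and \<open>\<iota>\<close> the canonical map into it. The predicates
  determine \<open>\<Delta>\<close>, \<open>\<epsilon>\<close> and \<open>T\<close> on the carrier of \<open>U\<close>; their values elsewhere are irrelevant.
\<close>

definition is_coproduct ::
    "('k::field, 'a) module \<Rightarrow> ('g \<Rightarrow> 'a) \<Rightarrow> ('a \<Rightarrow> ('a \<times> 'a \<Rightarrow>\<^sub>0 'k) set) \<Rightarrow> bool" where
  "is_coproduct U \<iota> \<Delta> \<longleftrightarrow> \<Delta> \<in> alg_hom U (tensor_square U) \<and>
    (\<forall>x. \<Delta> (\<iota> x) =
      pure_tensor U (\<iota> x) \<one>\<^bsub>U\<^esub> \<oplus>\<^bsub>tensor_square U\<^esub> pure_tensor U \<one>\<^bsub>U\<^esub> (\<iota> x))"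

definition is_counit :: "('k::field, 'a) module \<Rightarrow> ('g \<Rightarrow> 'a) \<Rightarrow> ('a \<Rightarrow> 'k) \<Rightarrow> bool" where
  "is_counit U \<iota> \<epsilon> \<longleftrightarrow> \<epsilon> \<in> alg_hom U base_field \<and> (\<forall>x. \<epsilon> (\<iota> x) = 0)"

definition bilinear_product :: "('k::field, 'a) module \<Rightarrow> ('a \<Rightarrow> 'a \<Rightarrow> 'a) \<Rightarrow> bool" where
  "bilinear_product U T \<longleftrightarrow>
    (\<forall>A\<in>carrier U. \<forall>B\<in>carrier U. T A B \<in> carrier U) \<and>
    (\<forall>A\<in>carrier U. \<forall>A'\<in>carrier U. \<forall>B\<in>carrier U. T (A \<oplus>\<^bsub>U\<^esub> A') B = T A B \<oplus>\<^bsub>U\<^esub> T A' B) \<and>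
    (\<forall>A\<in>carrier U. \<forall>B\<in>carrier U. \<forall>B'\<in>carrier U. T A (B \<oplus>\<^bsub>U\<^esub> B') = T A B \<oplus>\<^bsub>U\<^esub> T A B') \<and>
    (\<forall>c. \<forall>A\<in>carrier U. \<forall>B\<in>carrier U. T (c \<odot>\<^bsub>U\<^esub> A) B = c \<odot>\<^bsub>U\<^esub> T A B) \<and>
    (\<forall>c. \<forall>A\<in>carrier U. \<forall>B\<in>carrier U. T A (c \<odot>\<^bsub>U\<^esub> B) = c \<odot>\<^bsub>U\<^esub> T A B)"

definition is_post_lie_extension ::
    "('k::field, 'a) module \<Rightarrow> ('g \<Rightarrow> 'a) \<Rightarrow> ('a \<Rightarrow> ('a \<times> 'a \<Rightarrow>\<^sub>0 'k) set) \<Rightarrow> ('a \<Rightarrow> 'k)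
      \<Rightarrow> ('g \<Rightarrow> 'g \<Rightarrow> 'g) \<Rightarrow> ('a \<Rightarrow> 'a \<Rightarrow> 'a) \<Rightarrow> bool" where
  "is_post_lie_extension U \<iota> \<Delta> \<epsilon> t T \<longleftrightarrow>
    bilinear_product U T \<and>
    (\<forall>x y. T (\<iota> x) (\<iota> y) = \<iota> (t x y)) \<and>
    (\<forall>A\<in>carrier U. T \<one>\<^bsub>U\<^esub> A = A) \<and>
    (\<forall>A\<in>carrier U. T A \<one>\<^bsub>U\<^esub> = \<epsilon> A \<odot>\<^bsub>U\<^esub> \<one>\<^bsub>U\<^esub>) \<and>
    (\<forall>A\<in>carrier U. \<forall>B\<in>carrier U. \<forall>C\<in>carrier U.
      T A (B \<otimes>\<^bsub>U\<^esub> C) = sweedler U (\<lambda>A1 A2. T A1 B \<otimes>\<^bsub>U\<^esub> T A2 C) (\<Delta> A)) \<and>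
    (\<forall>x. \<forall>A\<in>carrier U. \<forall>B\<in>carrier U.
      T (\<iota> x \<otimes>\<^bsub>U\<^esub> A) B = T (\<iota> x) (T A B) \<ominus>\<^bsub>U\<^esub> T (T (\<iota> x) A) B)"

text \<open>The algebra \<open>U\<close> with its product replaced by \<open>A * B = A\<^sub>1 (A\<^sub>2 \<triangleright> B)\<close>, where \<open>T\<close> is \<open>\<triangleright>\<close>.\<close>

definition star_algebra ::
    "('k::field, 'a) module \<Rightarrow> ('a \<Rightarrow> ('a \<times> 'a \<Rightarrow>\<^sub>0 'k) set) \<Rightarrow> ('a \<Rightarrow> 'a \<Rightarrow> 'a)
      \<Rightarrow> ('k, 'a) module" where
  "star_algebra U \<Delta> T =
    U\<lparr>monoid.mult := \<lambda>A B. sweedler U (\<lambda>A1 A2. A1 \<otimes>\<^bsub>U\<^esub> T A2 B) (\<Delta> A)\<rparr>"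


section \<open>Formal power series with coefficients in an algebra\<close>

text \<open>
  A formal power series in the central parameter \<open>t\<close> over an algebra is its sequence of coefficients.
  \<open>exp_series A v\<close> is \<open>exp (t v) = \<Sum>\<^sub>n t\<^sup>n v\<^sup>n / n!\<close>, formed with the product of \<open>A\<close>.
  Powers are iterated left multiplications \<open>v (v (\<dots> (v 1)))\<close>; the bracketing is immaterial for an
  associative product.
\<close>

definition series_mult :: "('k, 'a) module \<Rightarrow> (nat \<Rightarrow> 'a) \<Rightarrow> (nat \<Rightarrow> 'a) \<Rightarrow> nat \<Rightarrow> 'a" where
  "series_mult A f g n = (\<Oplus>\<^bsub>A\<^esub>i\<in>{..n}. f i \<otimes>\<^bsub>A\<^esub> g (n - i))"

definition exp_series :: "('k::field_char_0, 'a) module \<Rightarrow> 'a \<Rightarrow> nat \<Rightarrow> 'a" where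
  "exp_series A v n = (1 / fact n) \<odot>\<^bsub>A\<^esub> (((\<lambda>w. v \<otimes>\<^bsub>A\<^esub> w) ^^ n) \<one>\<^bsub>A\<^esub>)"

end

theory Submission
  imports Defs
begin

text \<open>
  The element \<open>v\<close> is primitive, so \<open>v * B = v B + v \<triangleright> B\<close>, and \<open>v \<triangleright> _\<close> is a derivation of the enveloping
  algebra that kills the unit. On a generator \<open>y\<close> it takes the value
  \<open>-[v\<^sub>+, y] = y v\<^sub>+ - v\<^sub>+ y\<close>. The inner derivation \<open>w \<mapsto> w v\<^sub>+ - v\<^sub>+ w\<close> agrees with it there, and the Lie
  algebra generates, so the two agree everywhere. Since \<open>v = v\<^sub>- + v\<^sub>+\<close>, it follows that
  \<open>v * w = v\<^sub>- w + w v\<^sub>+\<close> for all \<open>w\<close>.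

  Left multiplication by \<open>v\<^sub>-\<close> commutes with right multiplication by \<open>v\<^sub>+\<close>. The binomial theorem for
  these two operators, applied to the unit, gives
  \<open>v\<^sup>*\<^sup>n = (\<Sum>i\<le>n. (n choose i) v\<^sub>-\<^sup>i v\<^sub>+\<^sup>n\<^sup>-\<^sup>i)\<close>. After division by \<open>n!\<close> this is the coefficient of
  \<open>t\<^sup>n\<close> in \<open>exp (t v\<^sub>-) exp (t v\<^sub>+)\<close>.

  The steps of this argument are \<open>star_primitive\<close>, \<open>derivation_primitive\<close>, \<open>derivation_eq_commutator\<close>
  and \<open>funpow_left_right_mult\<close>. All computations are carried out on representatives in the free
  algebra. A Sweedler sum is evaluated on a representative of the tensor
  \<open>\<Delta> v = v \<otimes> 1 + 1 \<otimes> v\<close>; by \<open>tensor_kernel_eval\<close> its value does not depend on the representative.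
\<close>

section \<open>The free algebra\<close>

abbreviation scalar_mult :: "'k::field \<Rightarrow> ('a \<Rightarrow>\<^sub>0 'k) \<Rightarrow> ('a \<Rightarrow>\<^sub>0 'k)" where
  "scalar_mult c \<equiv> Poly_Mapping.map ((*) c)"

lemma lookup_scalar_mult: "Poly_Mapping.lookup (scalar_mult c p) a = c * Poly_Mapping.lookup p a"
  by (simp add: Poly_Mapping.map.rep_eq when_def)

lemma keys_scalar_mult: "Poly_Mapping.keys (scalar_mult c p) \<subseteq> Poly_Mapping.keys p"
  by (auto simp: lookup_scalar_mult in_keys_iff)

lemma module_scalar_mult:
  "Modules.module (scalar_mult :: 'k::field \<Rightarrow> ('a \<Rightarrow>\<^sub>0 'k) \<Rightarrow> ('a \<Rightarrow>\<^sub>0 'k))"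
  by unfold_locales
    (auto intro!: poly_mapping_eqI simp: lookup_scalar_mult lookup_add algebra_simps)

lemma scalar_mult_eq_times:
  fixes p :: "('k::field, 'g) free_algebra"
  shows "scalar_mult c p = Poly_Mapping.single 0 c * p"
  by (rule mult_map_scale_conv_mult)

lemma scalar_mult_times_left:
  fixes p q :: "('k::field, 'g) free_algebra"
  shows "scalar_mult c p * q = scalar_mult c (p * q)"
  by (simp add: scalar_mult_eq_times mult.assoc)

text \<open>Constants are supported on the empty word, which is neutral for concatenation on both sides.\<close>

lemma times_single_zero_commute:
  fixes p :: "('k::field, 'g) free_algebra"
  shows "p * Poly_Mapping.single 0 c = Poly_Mapping.single 0 c * p"
proof (induction p rule: update_induct)
  case (update f a b)
  have "Poly_Mapping.update a b f = f + Poly_Mapping.single a b"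
    using update(1) by (auto intro!: poly_mapping_eqI
        simp: lookup_update lookup_add lookup_single in_keys_iff when_def)
  then show ?case using update
    by (simp add: distrib_right distrib_left mult_single mult.commute)
qed simp

lemma scalar_mult_times_right:
  fixes p q :: "('k::field, 'g) free_algebra"
  shows "p * scalar_mult c q = scalar_mult c (p * q)"
  by (simp only: scalar_mult_eq_times times_single_zero_commute flip: mult.assoc)

lemma ring_free_algebra:
  "Ring.ring (free_algebra :: ('k::field, ('k, 'g) free_algebra) module)"
proof (rule ringI)
  show "abelian_group (free_algebra :: ('k, ('k, 'g) free_algebra) module)"
    by (rule abelian_groupI) (auto simp: free_algebra_def add_ac intro: exI[of _ "- x" for x])
  show "Group.monoid (free_algebra :: ('k, ('k, 'g) free_algebra) module)"
    by (rule monoidI) (auto simp: free_algebra_def mult.assoc)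
qed (auto simp: free_algebra_def distrib_left distrib_right)

text \<open>
  The letters generate the free algebra: a basis vector is a product of letters, and every element is
  a linear combination of basis vectors.
\<close>

lemma free_algebra_induct [case_names one letter add scale mult]:
  fixes p :: "('k::field, 'g) free_algebra"
  assumes one: "P 1"
    and letter: "\<And>x. P (letter x)"
    and add: "\<And>p q. P p \<Longrightarrow> P q \<Longrightarrow> P (p + q)"
    and scale: "\<And>c p. P p \<Longrightarrow> P (scalar_mult c p)"
    and mult: "\<And>p q. P p \<Longrightarrow> P q \<Longrightarrow> P (p * q)"
  shows "P p"
proof (induction p rule: update_induct)
  case const
  have "scalar_mult 0 1 = (0 :: ('k, 'g) free_algebra)"
    by (rule poly_mapping_eqI) (simp add: lookup_scalar_mult)
  with scale[OF one, of 0] show ?case by simp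
next
  case (update f w c)
  have words: "P (Poly_Mapping.single (Word l) 1)" for l
  proof (induction l)
    case Nil
    have "Poly_Mapping.single (Word []) 1 = (1 :: ('k, 'g) free_algebra)"
      unfolding zero_word_def[symmetric] by simp
    then show ?case using one by simp
  next
    case (Cons x l)
    have "Poly_Mapping.single (Word (x # l)) 1
        = letter x * (Poly_Mapping.single (Word l) 1 :: ('k, 'g) free_algebra)"
      by (simp add: letter_def mult_single plus_word_def)
    then show ?case using mult[OF letter Cons.IH] by simp
  qed
  have "Poly_Mapping.update w c f = f + scalar_mult c (Poly_Mapping.single w 1)"
    using update(1) by (auto intro!: poly_mapping_eqI
        simp: lookup_update lookup_add lookup_single lookup_scalar_mult in_keys_iff when_def)
  then show ?case using add[OF update(3)] scale[OF words, of c "letters w"] by simp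
qed

text \<open>
  The binomial theorem for the commuting operators \<open>w \<mapsto> a w\<close> and \<open>w \<mapsto> w b\<close>, evaluated at the unit.
\<close>

lemma funpow_left_right_mult:
  fixes a b :: "'r::semiring_1"
  shows "((\<lambda>w. a * w + w * b) ^^ n) 1 = (\<Sum>i\<le>n. of_nat (n choose i) * (a ^ i * b ^ (n - i)))"
proof (induction n)
  case (Suc n)
  let ?s = "\<lambda>i. of_nat (n choose i) * (a ^ i * b ^ (Suc n - i))"
  have right: "(\<Sum>i\<le>n. of_nat (n choose i) * (a ^ i * b ^ (n - i))) * b = (\<Sum>i\<le>n. ?s i)"
    by (auto simp: sum_distrib_right mult.assoc Suc_diff_le power_Suc2 simp del: power_Suc
        intro!: sum.cong)
  have left: "a * (\<Sum>i\<le>n. of_nat (n choose i) * (a ^ i * b ^ (n - i)))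
      = (\<Sum>i\<le>n. of_nat (n choose i) * (a ^ Suc i * b ^ (n - i)))"
    unfolding sum_distrib_left
    by (rule sum.cong) (simp_all add: mult_of_nat_commute[of _ a] flip: mult.assoc)
  \<comment> \<open>The added summand \<open>i = n + 1\<close> vanishes; Pascal's rule then combines the two sums termwise.\<close>
  have "(\<Sum>i\<le>n. ?s i) = ?s 0 + (\<Sum>i\<le>n. ?s (Suc i))"
    using sum.atMost_Suc_shift[of ?s n] by (simp add: binomial_eq_0)
  then show ?case
    unfolding sum.atMost_Suc_shift using Suc left right
    by (simp add: sum.distrib distrib_right add_ac)
qed simp

section \<open>Quotients of the free algebra\<close>

text \<open>
  Every element of the quotient is the class of an element of the free algebra, and \<open>ops_Q\<close> turns
  an identity in the quotient into one between representatives.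
\<close>

locale free_algebra_quotient =
  fixes I :: "('k::field, 'g) free_algebra set"
  assumes ideal_I: "ideal I free_algebra"
begin

sublocale ideal I free_algebra by (rule ideal_I)

abbreviation cls :: "('k, 'g) free_algebra \<Rightarrow> ('k, 'g) free_algebra set" where
  "cls a \<equiv> I +>\<^bsub>free_algebra\<^esub> a"

abbreviation Q :: "('k, ('k, 'g) free_algebra set) module" where
  "Q \<equiv> quot_algebra free_algebra I"

text \<open>A ring ideal of a unital algebra is a subspace, since scalars act as multiplication by constants.\<close>

lemma scalar_mult_mem_ideal: "a \<in> I \<Longrightarrow> scalar_mult c a \<in> I"
  using I_l_closed[of a "Poly_Mapping.single 0 c"]
  by (simp add: free_algebra_def scalar_mult_eq_times)

lemma cls_eq_iff: "cls a = cls b \<longleftrightarrow> a - b \<in> I"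
proof
  have cls: "cls x = (\<lambda>i. i + x) ` I" for x
    by (auto simp: a_r_coset_def r_coset_def free_algebra_def)
  have add: "i + j \<in> I" if "i \<in> I" "j \<in> I" for i j
    using additive_subgroup.a_closed[OF is_additive_subgroup that] by (simp add: free_algebra_def)
  have scale: "- i \<in> I" if "i \<in> I" for i
    using I_l_closed[of i "- 1"] that by (simp add: free_algebra_def)
  have zero: "0 \<in> I"
    using additive_subgroup.zero_closed[OF is_additive_subgroup] by (simp add: free_algebra_def)
  {
    assume "cls a = cls b"
    then have "a \<in> cls b" using zero unfolding cls by force
    then show "a - b \<in> I" unfolding cls by auto
  next
    assume ab: "a - b \<in> I"
    have sub: "cls x \<subseteq> cls y" if "x - y \<in> I" for x y
      unfolding cls
    proof
      fix z assume "z \<in> (\<lambda>i. i + x) ` I"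
      then obtain i where "i \<in> I" "z = i + x" by auto
      then have "z = (i + (x - y)) + y" "i + (x - y) \<in> I" using add that by auto
      then show "z \<in> (\<lambda>i. i + y) ` I" by blast
    qed
    show "cls a = cls b" using sub[OF ab] sub[of b a] scale[OF ab] by auto
  }
qed

lemma carrier_Q: "carrier Q = range cls"
  by (auto simp: quot_algebra_def ring.defs module.defs FactRing_def A_RCOSETS_def' free_algebra_def)

lemma one_Q: "\<one>\<^bsub>Q\<^esub> = cls 1"
  by (simp add: quot_algebra_def ring.defs module.defs FactRing_def free_algebra_def)

lemma cls_zero: "cls 0 = I"
  using additive_subgroup.zero_closed[OF is_additive_subgroup]
  by (auto simp: a_r_coset_def r_coset_def free_algebra_def)

lemma zero_Q: "\<zero>\<^bsub>Q\<^esub> = cls 0"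
  by (simp add: cls_zero) (simp add: quot_algebra_def ring.defs module.defs FactRing_def)

lemma add_Q: "cls a \<oplus>\<^bsub>Q\<^esub> cls b = cls (a + b)"
  using a_rcos_sum[of a b]
  by (simp add: quot_algebra_def ring.defs module.defs FactRing_def)
    (simp add: free_algebra_def)

lemma mult_Q: "cls a \<otimes>\<^bsub>Q\<^esub> cls b = cls (a * b)"
  using rcoset_mult_add[of a b]
  by (simp add: quot_algebra_def ring.defs module.defs FactRing_def)
    (simp add: free_algebra_def)

lemma smult_Q: "c \<odot>\<^bsub>Q\<^esub> cls a = cls (scalar_mult c a)"
proof -
  have eq: "cls (scalar_mult c x) = cls (scalar_mult c a)" if "x \<in> cls a" for x
  proof -
    from that have "x - a \<in> I"
      by (auto simp: a_r_coset_def r_coset_def free_algebra_def)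
    then have "scalar_mult c (x - a) \<in> I" by (rule scalar_mult_mem_ideal)
    then show ?thesis by (simp add: cls_eq_iff scalar_mult_eq_times right_diff_distrib)
  qed
  have "a \<in> cls a"
    using additive_subgroup.zero_closed[OF is_additive_subgroup]
    by (force simp: a_r_coset_def r_coset_def free_algebra_def)
  then have "(\<Union>x\<in>cls a. cls (scalar_mult c x)) = cls (scalar_mult c a)"
    using eq by blast
  then show ?thesis
    by (simp add: quot_algebra_def ring.defs module.defs FactRing_def)
      (simp add: free_algebra_def)
qed

lemmas ops_Q = one_Q zero_Q add_Q mult_Q smult_Q

lemma ring_Q: "Ring.ring Q"
proof (rule ringI)
  show "abelian_group Q"
  proof (rule abelian_groupI)
    fix x assume "x \<in> carrier Q"
    then obtain a where "x = cls a" by (auto simp: carrier_Q)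
    then have "cls (- a) \<oplus>\<^bsub>Q\<^esub> x = \<zero>\<^bsub>Q\<^esub>" by (simp add: ops_Q)
    then show "\<exists>y\<in>carrier Q. y \<oplus>\<^bsub>Q\<^esub> x = \<zero>\<^bsub>Q\<^esub>" by (auto simp: carrier_Q)
  qed (auto simp: carrier_Q ops_Q add_ac)
  show "Group.monoid Q"
    by (rule monoidI) (auto simp: carrier_Q ops_Q mult.assoc)
qed (auto simp: carrier_Q ops_Q algebra_simps)

sublocale Q: Ring.ring Q by (rule ring_Q)

lemma module_Q: "Module.module base_field Q"
proof (rule moduleI)
  show "cring (base_field :: ('k, 'k) module)"
  proof (rule cringI)
    show "abelian_group (base_field :: ('k, 'k) module)"
      by (rule abelian_groupI) (auto simp: base_field_def add_ac intro: exI[of _ "- x" for x])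
    show "comm_monoid (base_field :: ('k, 'k) module)"
      by (rule comm_monoidI) (auto simp: base_field_def mult_ac)
  qed (simp add: base_field_def distrib_right)
qed (auto simp: carrier_Q ops_Q base_field_def scalar_mult_eq_times Q.abelian_group_axioms
    single_add distrib_right distrib_left mult_single simp flip: mult.assoc)

lemma finsum_Q: "finite S \<Longrightarrow> (\<Oplus>\<^bsub>Q\<^esub>i\<in>S. cls (f i)) = cls (\<Sum>i\<in>S. f i)"
  by (induction S rule: finite_induct) (auto simp: ops_Q carrier_Q)

end

section \<open>Evaluating Sweedler sums\<close>

text \<open>
  The value that a bilinear map assigns to a formal linear combination of pairs, before the
  bilinearity relations are divided out.
\<close>

definition tensor_eval ::
    "('k::field, 'a) module \<Rightarrow> ('a \<Rightarrow> 'a \<Rightarrow> 'a) \<Rightarrow> ('a \<times> 'a \<Rightarrow>\<^sub>0 'k) \<Rightarrow> 'a" where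
  "tensor_eval A f p =
    (\<Oplus>\<^bsub>A\<^esub>ab\<in>Poly_Mapping.keys p. Poly_Mapping.lookup p ab \<odot>\<^bsub>A\<^esub> f (fst ab) (snd ab))"

locale bilinear_map = Module.module base_field A for A :: "('k::field, 'a) module" +
  fixes f :: "'a \<Rightarrow> 'a \<Rightarrow> 'a"
  assumes bilinear: "bilinear_product A f"
begin

abbreviation C :: "('a \<times> 'a) set" where "C \<equiv> carrier A \<times> carrier A"

abbreviation eval :: "('a \<times> 'a \<Rightarrow>\<^sub>0 'k) \<Rightarrow> 'a" where "eval \<equiv> tensor_eval A f"

lemma f_closed [simp]: "a \<in> carrier A \<Longrightarrow> b \<in> carrier A \<Longrightarrow> f a b \<in> carrier A"
  using bilinear unfolding bilinear_product_def by blast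

lemma scale_closed [simp]: "a \<in> carrier A \<Longrightarrow> c \<odot>\<^bsub>A\<^esub> a \<in> carrier A"
  using smult_closed[of c a] by (simp add: base_field_def)

lemma scale_zero [simp]: "a \<in> carrier A \<Longrightarrow> 0 \<odot>\<^bsub>A\<^esub> a = \<zero>\<^bsub>A\<^esub>"
  using smult_l_null[of a] by (simp add: base_field_def)

lemma scale_one [simp]: "a \<in> carrier A \<Longrightarrow> 1 \<odot>\<^bsub>A\<^esub> a = a"
  using smult_one[of a] by (simp add: base_field_def)

lemma scale_add: "a \<in> carrier A \<Longrightarrow> (c + d) \<odot>\<^bsub>A\<^esub> a = c \<odot>\<^bsub>A\<^esub> a \<oplus>\<^bsub>A\<^esub> d \<odot>\<^bsub>A\<^esub> a"
  using smult_l_distr[of c d a] by (simp add: base_field_def)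

lemma scale_scale: "a \<in> carrier A \<Longrightarrow> (c * d) \<odot>\<^bsub>A\<^esub> a = c \<odot>\<^bsub>A\<^esub> (d \<odot>\<^bsub>A\<^esub> a)"
  using smult_assoc1[of c d a] by (simp add: base_field_def)

lemma scale_finsum:
  "finite S \<Longrightarrow> g \<in> S \<rightarrow> carrier A \<Longrightarrow> c \<odot>\<^bsub>A\<^esub> (\<Oplus>\<^bsub>A\<^esub>i\<in>S. g i) = (\<Oplus>\<^bsub>A\<^esub>i\<in>S. c \<odot>\<^bsub>A\<^esub> g i)"
  using finsum_smult_ldistr[of S c g] by (simp add: base_field_def)

text \<open>Two combinations with different supports are compared by summing over a common finite index set.\<close>

lemma eval_superset:
  assumes "finite S" "Poly_Mapping.keys p \<subseteq> S" "S \<subseteq> C"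
  shows "eval p = (\<Oplus>\<^bsub>A\<^esub>ab\<in>S. Poly_Mapping.lookup p ab \<odot>\<^bsub>A\<^esub> f (fst ab) (snd ab))"
  unfolding tensor_eval_def
proof (rule add.finprod_mono_neutral_cong_left)
  fix i assume "i \<in> S - Poly_Mapping.keys p"
  then show "Poly_Mapping.lookup p i \<odot>\<^bsub>A\<^esub> f (fst i) (snd i) = \<zero>\<^bsub>A\<^esub>"
    using assms by (auto simp: in_keys_iff)
qed (use assms in auto)

lemma eval_closed: "Poly_Mapping.keys p \<subseteq> C \<Longrightarrow> eval p \<in> carrier A"
  unfolding tensor_eval_def by (rule finsum_closed) auto

lemma eval_add:
  assumes p: "Poly_Mapping.keys p \<subseteq> C" and q: "Poly_Mapping.keys q \<subseteq> C"
  shows "eval (p + q) = eval p \<oplus>\<^bsub>A\<^esub> eval q"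
proof -
  define S where "S = Poly_Mapping.keys p \<union> Poly_Mapping.keys q"
  have S: "finite S" "Poly_Mapping.keys p \<subseteq> S" "Poly_Mapping.keys q \<subseteq> S" "S \<subseteq> C"
    "Poly_Mapping.keys (p + q) \<subseteq> S"
    using p q keys_add[of p q] by (auto simp: S_def)
  let ?t = "\<lambda>r ab. Poly_Mapping.lookup r ab \<odot>\<^bsub>A\<^esub> f (fst ab) (snd ab)"
  have closed: "?t r \<in> S \<rightarrow> carrier A" for r using S(4) by auto
  have "(\<Oplus>\<^bsub>A\<^esub>ab\<in>S. ?t (p + q) ab) = (\<Oplus>\<^bsub>A\<^esub>ab\<in>S. ?t p ab \<oplus>\<^bsub>A\<^esub> ?t q ab)"
    by (rule finsum_cong') (use S(4) in \<open>auto simp: lookup_add scale_add\<close>)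
  also have "\<dots> = (\<Oplus>\<^bsub>A\<^esub>ab\<in>S. ?t p ab) \<oplus>\<^bsub>A\<^esub> (\<Oplus>\<^bsub>A\<^esub>ab\<in>S. ?t q ab)"
    by (rule finsum_addf[OF closed closed])
  finally show ?thesis using S by (simp add: eval_superset[of S])
qed

lemma eval_scalar_mult:
  assumes p: "Poly_Mapping.keys p \<subseteq> C"
  shows "eval (scalar_mult c p) = c \<odot>\<^bsub>A\<^esub> eval p"
proof -
  let ?t = "\<lambda>r ab. Poly_Mapping.lookup r ab \<odot>\<^bsub>A\<^esub> f (fst ab) (snd ab)"
  have "eval (scalar_mult c p) = (\<Oplus>\<^bsub>A\<^esub>ab\<in>Poly_Mapping.keys p. ?t (scalar_mult c p) ab)"
    by (rule eval_superset) (use p keys_scalar_mult[of c p] in auto)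
  also have "\<dots> = (\<Oplus>\<^bsub>A\<^esub>ab\<in>Poly_Mapping.keys p. c \<odot>\<^bsub>A\<^esub> ?t p ab)"
    by (rule finsum_cong') (use p in \<open>auto simp: lookup_scalar_mult scale_scale\<close>)
  also have "\<dots> = c \<odot>\<^bsub>A\<^esub> eval p"
    unfolding tensor_eval_def by (rule scale_finsum[symmetric]) (use p in auto)
  finally show ?thesis .
qed

lemma eval_single: "a \<in> carrier A \<Longrightarrow> b \<in> carrier A \<Longrightarrow> eval (Poly_Mapping.single (a, b) 1) = f a b"
  by (subst eval_superset[of "{(a, b)}"]) auto

lemma keys_diff_subset:
  "Poly_Mapping.keys p \<subseteq> C \<Longrightarrow> Poly_Mapping.keys q \<subseteq> C \<Longrightarrow> Poly_Mapping.keys (p - q) \<subseteq> C"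
  using keys_diff[of p q] by blast

lemma keys_add_subset:
  "Poly_Mapping.keys p \<subseteq> C \<Longrightarrow> Poly_Mapping.keys q \<subseteq> C \<Longrightarrow> Poly_Mapping.keys (p + q) \<subseteq> C"
  using keys_add[of p q] by blast

lemma eval_diff_eq_zero:
  assumes p: "Poly_Mapping.keys p \<subseteq> C" and q: "Poly_Mapping.keys q \<subseteq> C" and eq: "eval p = eval q"
  shows "eval (p - q) = \<zero>\<^bsub>A\<^esub>"
proof -
  have "eval (p - q) \<oplus>\<^bsub>A\<^esub> eval q = eval q"
    using eval_add[OF keys_diff_subset[OF p q] q] eq by simp
  then show ?thesis
    using eval_closed[OF q] eval_closed[OF keys_diff_subset[OF p q]] by (metis add.r_cancel_one)
qed

text \<open>
  A bilinear map factors through the tensor square. The claim on keys has to be proved along with the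
  vanishing, because bilinearity holds on the carrier only.
\<close>

lemma tensor_kernel_eval:
  assumes "p \<in> tensor_kernel A"
  shows "Poly_Mapping.keys p \<subseteq> C \<and> eval p = \<zero>\<^bsub>A\<^esub>"
proof -
  interpret P: Modules.module "scalar_mult :: 'k \<Rightarrow> ('a \<times> 'a \<Rightarrow>\<^sub>0 'k) \<Rightarrow> _"
    by (rule module_scalar_mult)
  let ?e = "\<lambda>a b. Poly_Mapping.single (a, b) (1::'k)"
  have e: "Poly_Mapping.keys (?e a b) \<subseteq> C" if "a \<in> carrier A" "b \<in> carrier A" for a b
    using that by simp
  have s: "Poly_Mapping.keys (scalar_mult c p) \<subseteq> C" if "Poly_Mapping.keys p \<subseteq> C" for c and p :: "'a \<times> 'a \<Rightarrow>\<^sub>0 'k"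
    using that keys_scalar_mult[of c p] by blast
  have relations: "Poly_Mapping.keys r \<subseteq> C \<and> eval r = \<zero>\<^bsub>A\<^esub>" if "r \<in> tensor_relations A" for r
    using that unfolding tensor_relations_def Let_def
    by (elim UnE CollectE exE conjE; hypsubst; intro conjI keys_diff_subset eval_diff_eq_zero e s keys_add_subset;
        insert bilinear; simp add: bilinear_product_def eval_add eval_scalar_mult eval_single e del: map_single)
  show ?thesis
    using assms unfolding tensor_kernel_def
  proof (induction rule: P.span_induct_alt)
    case base
    show ?case by (simp add: tensor_eval_def)
  next
    case (step c x y)
    have x: "Poly_Mapping.keys x \<subseteq> C" "eval x = \<zero>\<^bsub>A\<^esub>" using relations[OF step(1)] by auto
    have "c \<odot>\<^bsub>A\<^esub> \<zero>\<^bsub>A\<^esub> = \<zero>\<^bsub>A\<^esub>"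
      using smult_r_null[of c] by (simp add: base_field_def)
    then show ?case using x step(2) s[OF x(1), of c]
      by (simp add: keys_add_subset eval_add eval_scalar_mult)
  qed
qed

text \<open>
  The sum of two cosets is the set of all sums of representatives, so whichever representative the
  Sweedler sum selects, it differs from the obvious one by an element of the kernel.
\<close>

lemma sweedler_sum_of_two:
  assumes "a \<in> carrier A" "b \<in> carrier A" "c \<in> carrier A" "d \<in> carrier A"
  shows "sweedler A f (pure_tensor A a b \<oplus>\<^bsub>tensor_square A\<^esub> pure_tensor A c d) = f a b \<oplus>\<^bsub>A\<^esub> f c d"
proof -
  interpret P: Modules.module "scalar_mult :: 'k \<Rightarrow> ('a \<times> 'a \<Rightarrow>\<^sub>0 'k) \<Rightarrow> _"
    by (rule module_scalar_mult)
  let ?X = "pure_tensor A a b \<oplus>\<^bsub>tensor_square A\<^esub> pure_tensor A c d"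
  let ?K = "tensor_kernel A"
  let ?e = "\<lambda>a b. Poly_Mapping.single (a, b) (1::'k)"
  have X: "?X = {(k + ?e a b) + (l + ?e c d) | k l. k \<in> ?K \<and> l \<in> ?K}"
    by (auto simp: tensor_square_def quot_algebra_def ring.defs module.defs FactRing_def pure_tensor_def
        set_add_def set_mult_def a_r_coset_def r_coset_def) (auto simp: pair_algebra_def)
  have "0 \<in> ?K" unfolding tensor_kernel_def by (rule P.span_zero)
  then have "?X \<noteq> {}" unfolding X by blast
  then have "(SOME p. p \<in> ?X) \<in> ?X" by (simp add: some_in_eq)
  then obtain k l where p: "(SOME p. p \<in> ?X) = (k + ?e a b) + (l + ?e c d)" and "k \<in> ?K" "l \<in> ?K"
    unfolding X by auto
  with tensor_kernel_eval[of k] tensor_kernel_eval[of l] assms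
  have "eval (SOME p. p \<in> ?X) = f a b \<oplus>\<^bsub>A\<^esub> f c d"
    by (simp add: eval_add keys_add_subset eval_single)
  then show ?thesis by (simp add: sweedler_def tensor_eval_def Let_def)
qed

end

section \<open>Primitive elements\<close>

context free_algebra_quotient
begin

definition primitive where
  "primitive \<Delta> X \<longleftrightarrow> X \<in> carrier Q \<and>
    \<Delta> X = pure_tensor Q X \<one>\<^bsub>Q\<^esub> \<oplus>\<^bsub>tensor_square Q\<^esub> pure_tensor Q \<one>\<^bsub>Q\<^esub> X"

lemma sweedler_primitive:
  assumes "primitive \<Delta> X" "bilinear_product Q f"
  shows "sweedler Q f (\<Delta> X) = f X \<one>\<^bsub>Q\<^esub> \<oplus>\<^bsub>Q\<^esub> f \<one>\<^bsub>Q\<^esub> X"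
proof -
  interpret bilinear_map Q f
    using module_Q assms(2) by (intro bilinear_map.intro bilinear_map_axioms.intro)
  show ?thesis using assms(1) sweedler_sum_of_two[of X "\<one>\<^bsub>Q\<^esub>" "\<one>\<^bsub>Q\<^esub>" X]
    by (simp add: primitive_def)
qed

lemma smult_mult_left:
  "X \<in> carrier Q \<Longrightarrow> Y \<in> carrier Q \<Longrightarrow> (c \<odot>\<^bsub>Q\<^esub> X) \<otimes>\<^bsub>Q\<^esub> Y = c \<odot>\<^bsub>Q\<^esub> (X \<otimes>\<^bsub>Q\<^esub> Y)"
  by (auto simp: carrier_Q ops_Q scalar_mult_times_left)

lemma smult_mult_right:
  "X \<in> carrier Q \<Longrightarrow> Y \<in> carrier Q \<Longrightarrow> X \<otimes>\<^bsub>Q\<^esub> (c \<odot>\<^bsub>Q\<^esub> Y) = c \<odot>\<^bsub>Q\<^esub> (X \<otimes>\<^bsub>Q\<^esub> Y)"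
  by (auto simp: carrier_Q ops_Q scalar_mult_times_right)

lemma smult_closed_Q: "X \<in> carrier Q \<Longrightarrow> c \<odot>\<^bsub>Q\<^esub> X \<in> carrier Q"
  by (auto simp: carrier_Q ops_Q)

text \<open>The two summands of the coproduct of \<open>X\<close> contribute \<open>X (1 \<triangleright> B)\<close> and \<open>1 (X \<triangleright> B)\<close>.\<close>

lemma star_primitive:
  assumes X: "primitive \<Delta> X" and T: "bilinear_product Q T"
    and T_one: "\<And>A. A \<in> carrier Q \<Longrightarrow> T \<one>\<^bsub>Q\<^esub> A = A"
    and B: "B \<in> carrier Q"
  shows "X \<otimes>\<^bsub>star_algebra Q \<Delta> T\<^esub> B = X \<otimes>\<^bsub>Q\<^esub> B \<oplus>\<^bsub>Q\<^esub> T X B"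
proof -
  have "bilinear_product Q (\<lambda>A1 A2. A1 \<otimes>\<^bsub>Q\<^esub> T A2 B)"
    using T B unfolding bilinear_product_def
    by (auto simp: smult_mult_left smult_mult_right Q.l_distr Q.r_distr smult_closed_Q)
  moreover have "X \<in> carrier Q" "T X B \<in> carrier Q"
    using X T B by (auto simp: primitive_def bilinear_product_def)
  ultimately show ?thesis
    using sweedler_primitive[OF X] T_one[OF B] by (simp add: star_algebra_def)
qed

text \<open>
  The left-hand side is the value that a post-Lie extension prescribes for \<open>X \<triangleright> (B C)\<close>; so for
  primitive \<open>X\<close> the prescription is the Leibniz rule.
\<close>

lemma derivation_primitive:
  assumes X: "primitive \<Delta> X" and T: "bilinear_product Q T"
    and T_one: "\<And>A. A \<in> carrier Q \<Longrightarrow> T \<one>\<^bsub>Q\<^esub> A = A"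
    and B: "B \<in> carrier Q" and C: "C \<in> carrier Q"
  shows "sweedler Q (\<lambda>A1 A2. T A1 B \<otimes>\<^bsub>Q\<^esub> T A2 C) (\<Delta> X) = T X B \<otimes>\<^bsub>Q\<^esub> C \<oplus>\<^bsub>Q\<^esub> B \<otimes>\<^bsub>Q\<^esub> T X C"
proof -
  have "bilinear_product Q (\<lambda>A1 A2. T A1 B \<otimes>\<^bsub>Q\<^esub> T A2 C)"
    using T B C unfolding bilinear_product_def
    by (auto simp: smult_mult_left smult_mult_right Q.l_distr Q.r_distr smult_closed_Q)
  then show ?thesis using sweedler_primitive[OF X] T_one B C by simp
qed

text \<open>
  A derivation is determined by its values on generators. The right-hand side is the inner derivation
  given by the commutator with \<open>b\<close>.
\<close>

lemma derivation_eq_commutator: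
  assumes add: "\<And>A B. A \<in> carrier Q \<Longrightarrow> B \<in> carrier Q \<Longrightarrow> D (A \<oplus>\<^bsub>Q\<^esub> B) = D A \<oplus>\<^bsub>Q\<^esub> D B"
    and scale: "\<And>c A. A \<in> carrier Q \<Longrightarrow> D (c \<odot>\<^bsub>Q\<^esub> A) = c \<odot>\<^bsub>Q\<^esub> D A"
    and leibniz: "\<And>A B. A \<in> carrier Q \<Longrightarrow> B \<in> carrier Q \<Longrightarrow>
      D (A \<otimes>\<^bsub>Q\<^esub> B) = D A \<otimes>\<^bsub>Q\<^esub> B \<oplus>\<^bsub>Q\<^esub> A \<otimes>\<^bsub>Q\<^esub> D B"
    and one: "D \<one>\<^bsub>Q\<^esub> = \<zero>\<^bsub>Q\<^esub>"
    and letter: "\<And>x. D (cls (letter x)) = cls (letter x * b - b * letter x)"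
  shows "D (cls w) = cls (w * b - b * w)"
proof (induction w rule: free_algebra_induct)
  case one
  show ?case using assms(4) by (simp add: ops_Q)
next
  case (letter x)
  show ?case by (rule assms(5))
next
  case (add p q)
  have "D (cls (p + q)) = D (cls p) \<oplus>\<^bsub>Q\<^esub> D (cls q)"
    using assms(1)[of "cls p" "cls q"] by (simp add: carrier_Q ops_Q)
  then show ?case using add by (simp add: ops_Q algebra_simps)
next
  case (scale c p)
  have "D (cls (scalar_mult c p)) = c \<odot>\<^bsub>Q\<^esub> D (cls p)"
    using assms(2)[of "cls p" c] by (simp add: carrier_Q ops_Q)
  then show ?case using scale
    by (simp add: ops_Q scalar_mult_times_left scalar_mult_times_right)
      (simp add: scalar_mult_eq_times right_diff_distrib)
next
  case (mult p q)
  have "D (cls (p * q)) = D (cls p) \<otimes>\<^bsub>Q\<^esub> cls q \<oplus>\<^bsub>Q\<^esub> cls p \<otimes>\<^bsub>Q\<^esub> D (cls q)"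
    using assms(3)[of "cls p" "cls q"] by (simp add: carrier_Q ops_Q)
  then show ?case using mult by (simp add: ops_Q algebra_simps)
qed

end

section \<open>Exponential series\<close>

text \<open>
  The algebra \<open>A\<close> may carry a product other than that of the quotient. It is enough that left
  multiplication by \<open>X\<close> lifts to an operator \<open>M\<close> on the free algebra.
\<close>

lemma exp_series_cls:
  fixes I :: "('k::field_char_0, 'g) free_algebra set"
  assumes "free_algebra_quotient I"
    and A: "smult A = smult (quot_algebra free_algebra I)" "\<one>\<^bsub>A\<^esub> = \<one>\<^bsub>quot_algebra free_algebra I\<^esub>"
    and M: "\<And>w. X \<otimes>\<^bsub>A\<^esub> (I +>\<^bsub>free_algebra\<^esub> w) = I +>\<^bsub>free_algebra\<^esub> M w"
  shows "exp_series A X n = I +>\<^bsub>free_algebra\<^esub> scalar_mult (1 / fact n) ((M ^^ n) 1)"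
proof -
  interpret free_algebra_quotient I by fact
  have "((\<lambda>w. X \<otimes>\<^bsub>A\<^esub> w) ^^ n) \<one>\<^bsub>Q\<^esub> = cls ((M ^^ n) 1)"
    by (induction n) (simp_all add: M one_Q)
  then show ?thesis by (simp add: exp_series_def A smult_Q)
qed

text \<open>
  The coefficient \<open>1 / (i! (n - i)!)\<close> of the product of two exponentials is \<open>(n choose i) / n!\<close>, which
  matches the binomial expansion of the powers of \<open>w \<mapsto> a w + w b\<close>.
\<close>

lemma exp_series_mult_eq:
  fixes I :: "('k::field_char_0, 'g) free_algebra set"
  assumes "free_algebra_quotient I"
  defines "Q \<equiv> quot_algebra free_algebra I"
  shows "series_mult Q (exp_series Q (I +>\<^bsub>free_algebra\<^esub> a)) (exp_series Q (I +>\<^bsub>free_algebra\<^esub> b)) n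
    = I +>\<^bsub>free_algebra\<^esub> scalar_mult (1 / fact n) (((\<lambda>w. a * w + w * b) ^^ n) 1)"
proof -
  interpret I: free_algebra_quotient I by fact
  have power: "((\<lambda>w. c * w) ^^ m) 1 = c ^ m" for c :: "('k, 'g) free_algebra" and m
    by (induction m) simp_all
  have exp: "exp_series Q (I.cls c) m = I.cls (scalar_mult (1 / fact m) (c ^ m))" for c m
    using exp_series_cls[OF assms(1) refl refl I.mult_Q, of c m] by (simp add: Q_def power)
  have coeff: "scalar_mult (1 / fact i) (a ^ i) * scalar_mult (1 / fact (n - i)) (b ^ (n - i))
      = scalar_mult (1 / fact n) (of_nat (n choose i) * (a ^ i * b ^ (n - i)))" if "i \<le> n" for i
  proof -
    have binomial: "1 / fact (n - i) * (1 / fact i) = 1 / fact n * (of_nat (n choose i) :: 'k)"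
      using that by (simp add: binomial_fact mult.commute)
    have "scalar_mult (1 / fact i) (a ^ i) * scalar_mult (1 / fact (n - i)) (b ^ (n - i))
        = Poly_Mapping.single 0 (1 / fact (n - i) * (1 / fact i)) * (a ^ i * b ^ (n - i))"
      unfolding scalar_mult_times_left scalar_mult_times_right
      unfolding scalar_mult_eq_times by (simp only: mult_single add_0_left flip: mult.assoc)
    also have "\<dots> = Poly_Mapping.single 0 (1 / fact n) * (Poly_Mapping.single 0 (of_nat (n choose i))
        * (a ^ i * b ^ (n - i)))"
      unfolding binomial by (simp only: mult_single add_0_left flip: mult.assoc)
    finally show ?thesis by (simp only: scalar_mult_eq_times single_of_nat)
  qed
  have "series_mult Q (exp_series Q (I.cls a)) (exp_series Q (I.cls b)) n
      = I.cls (\<Sum>i\<le>n. scalar_mult (1 / fact i) (a ^ i) * scalar_mult (1 / fact (n - i)) (b ^ (n - i)))"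
    unfolding series_mult_def exp unfolding Q_def I.mult_Q by (rule I.finsum_Q) simp
  also have "(\<Sum>i\<le>n. scalar_mult (1 / fact i) (a ^ i) * scalar_mult (1 / fact (n - i)) (b ^ (n - i)))
      = (\<Sum>i\<le>n. scalar_mult (1 / fact n) (of_nat (n choose i) * (a ^ i * b ^ (n - i))))"
    by (rule sum.cong[OF refl], rule coeff) simp
  also have "\<dots> = scalar_mult (1 / fact n) (\<Sum>i\<le>n. of_nat (n choose i) * (a ^ i * b ^ (n - i)))"
    unfolding scalar_mult_eq_times by (rule sum_distrib_left[symmetric])
  finally show ?thesis by (simp only: funpow_left_right_mult)
qed

section \<open>The factorization\<close>

lemma free_algebra_quotient_uea: "free_algebra_quotient (uea_ideal scale bracket)"
  unfolding uea_ideal_def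
  by (rule free_algebra_quotient.intro, rule ring.genideal_ideal[OF ring_free_algebra])
    (simp add: free_algebra_def)

lemma uea_relations_subset: "uea_relations scale bracket \<subseteq> uea_ideal scale bracket"
  unfolding uea_ideal_def by (rule ring.genideal_self[OF ring_free_algebra]) (simp add: free_algebra_def)

lemma uea_incl_add:
  "uea_incl scale bracket (x + y)
    = uea_ideal scale bracket +>\<^bsub>free_algebra\<^esub> (letter x + letter y)"
proof -
  interpret free_algebra_quotient "uea_ideal scale bracket" by (rule free_algebra_quotient_uea)
  have "letter (x + y) - (letter x + letter y) \<in> uea_relations scale bracket"
    unfolding uea_relations_def by blast
  then show ?thesis using uea_relations_subset by (auto simp: uea_incl_def cls_eq_iff)
qed

lemma uea_incl_bracket:
  "uea_incl scale bracket (bracket x y)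
    = uea_ideal scale bracket +>\<^bsub>free_algebra\<^esub> (letter x * letter y - letter y * letter x)"
proof -
  interpret free_algebra_quotient "uea_ideal scale bracket" by (rule free_algebra_quotient_uea)
  have "letter x * letter y - letter y * letter x - letter (bracket x y) \<in> uea_relations scale bracket"
    unfolding uea_relations_def by blast
  then have "cls (letter x * letter y - letter y * letter x) = cls (letter (bracket x y))"
    using uea_relations_subset unfolding cls_eq_iff by blast
  then show ?thesis by (simp add: uea_incl_def)
qed

lemma (in lie_algebra) bracket_antisym: "- bracket x y = bracket y x"
proof (rule minus_unique)
  show "bracket x y + bracket y x = 0"
    using bracket_self[of "x + y"] unfolding bracket_add_left bracket_add_right
    by (simp add: bracket_self add.commute)
qed

theorem proposition4p5:
  fixes scale :: "'k::field_char_0 \<Rightarrow> 'g::ab_group_add \<Rightarrow> 'g"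
    and bracket :: "'g \<Rightarrow> 'g \<Rightarrow> 'g"
    and pi_plus pi_minus :: "'g \<Rightarrow> 'g"
    and U :: "('k, ('k, 'g) free_algebra set) module"
    and \<iota> :: "'g \<Rightarrow> ('k, 'g) free_algebra set"
    and \<Delta> :: "('k, 'g) free_algebra set
      \<Rightarrow> (('k, 'g) free_algebra set \<times> ('k, 'g) free_algebra set \<Rightarrow>\<^sub>0 'k) set"
    and \<epsilon> :: "('k, 'g) free_algebra set \<Rightarrow> 'k"
    and T :: "('k, 'g) free_algebra set \<Rightarrow> ('k, 'g) free_algebra set \<Rightarrow> ('k, 'g) free_algebra set"
    and v :: 'g
  defines "U \<equiv> uea scale bracket"
    and "\<iota> \<equiv> uea_incl scale bracket"
    and "pi_minus \<equiv> (\<lambda>x. x - pi_plus x)"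
  assumes "lie_algebra scale bracket"
    and "Vector_Spaces.linear scale scale pi_plus"
    and "\<And>x y. bracket (pi_plus x) (pi_plus y) + pi_plus (bracket x y)
           = pi_plus (bracket (pi_plus x) y + bracket x (pi_plus y))"
    and "is_coproduct U \<iota> \<Delta>"
    and "is_counit U \<iota> \<epsilon>"
    and "is_post_lie_extension U \<iota> \<Delta> \<epsilon> (\<lambda>x y. - bracket (pi_plus x) y) T"
  shows "exp_series (star_algebra U \<Delta> T) (\<iota> v)
       = series_mult U (exp_series U (\<iota> (pi_minus v))) (exp_series U (\<iota> (pi_plus v)))"
proof
  fix n
  interpret L: lie_algebra scale bracket by fact
  interpret I: free_algebra_quotient "uea_ideal scale bracket" by (rule free_algebra_quotient_uea)
  have U: "U = I.Q" by (simp add: U_def uea_def)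
  have \<iota>: "\<iota> x = I.cls (letter x)" for x by (simp add: \<iota>_def uea_incl_def)
  have primitive: "I.primitive \<Delta> (\<iota> v)"
    using assms(7) by (simp add: is_coproduct_def I.primitive_def U \<iota> I.carrier_Q)
  have bilinear: "bilinear_product I.Q T"
    and T_\<iota>: "T (\<iota> x) (\<iota> y) = \<iota> (- bracket (pi_plus x) y)"
    and T_one_left: "A \<in> carrier I.Q \<Longrightarrow> T \<one>\<^bsub>I.Q\<^esub> A = A"
    and T_one_right: "A \<in> carrier I.Q \<Longrightarrow> T A \<one>\<^bsub>I.Q\<^esub> = \<epsilon> A \<odot>\<^bsub>I.Q\<^esub> \<one>\<^bsub>I.Q\<^esub>"
    and T_mult: "A \<in> carrier I.Q \<Longrightarrow> B \<in> carrier I.Q \<Longrightarrow> C \<in> carrier I.Q \<Longrightarrow>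
      T A (B \<otimes>\<^bsub>I.Q\<^esub> C) = sweedler I.Q (\<lambda>A1 A2. T A1 B \<otimes>\<^bsub>I.Q\<^esub> T A2 C) (\<Delta> A)" for A B C x y
    using assms(9) unfolding U is_post_lie_extension_def by blast+
  have v_carrier: "\<iota> v \<in> carrier I.Q" by (simp add: \<iota> I.carrier_Q)
  let ?a = "letter (pi_minus v) :: ('k, 'g) free_algebra"
  let ?b = "letter (pi_plus v) :: ('k, 'g) free_algebra"
  have T_v: "T (\<iota> v) (I.cls w) = I.cls (w * ?b - ?b * w)" for w
  proof (rule I.derivation_eq_commutator[where D = "T (\<iota> v)"])
    show "T (\<iota> v) (A \<otimes>\<^bsub>I.Q\<^esub> B) = T (\<iota> v) A \<otimes>\<^bsub>I.Q\<^esub> B \<oplus>\<^bsub>I.Q\<^esub> A \<otimes>\<^bsub>I.Q\<^esub> T (\<iota> v) B"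
      if "A \<in> carrier I.Q" "B \<in> carrier I.Q" for A B
      using that T_mult[OF v_carrier] I.derivation_primitive[OF primitive bilinear T_one_left] by simp
    have "\<epsilon> (\<iota> v) = 0" using assms(8) by (simp add: is_counit_def)
    then have "T (\<iota> v) \<one>\<^bsub>I.Q\<^esub> = 0 \<odot>\<^bsub>I.Q\<^esub> \<one>\<^bsub>I.Q\<^esub>" by (simp add: T_one_right[OF v_carrier])
    then show "T (\<iota> v) \<one>\<^bsub>I.Q\<^esub> = \<zero>\<^bsub>I.Q\<^esub>"
      unfolding I.ops_Q by (simp add: scalar_mult_eq_times)
    show "T (\<iota> v) (I.cls (letter x)) = I.cls (letter x * ?b - ?b * letter x)" for x
      using T_\<iota>[of v x] uea_incl_bracket[of scale bracket x "pi_plus v"]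
      by (simp add: L.bracket_antisym \<iota>) (simp add: uea_incl_def)
  qed (use bilinear v_carrier in \<open>auto simp: bilinear_product_def\<close>)
  have star: "\<iota> v \<otimes>\<^bsub>star_algebra U \<Delta> T\<^esub> I.cls w = I.cls (?a * w + w * ?b)" for w
  proof -
    have v: "\<iota> v = I.cls (?a + ?b)"
      using uea_incl_add[of scale bracket "pi_minus v" "pi_plus v"]
      by (simp add: \<iota>_def pi_minus_def)
    have "\<iota> v \<otimes>\<^bsub>star_algebra U \<Delta> T\<^esub> I.cls w = \<iota> v \<otimes>\<^bsub>I.Q\<^esub> I.cls w \<oplus>\<^bsub>I.Q\<^esub> T (\<iota> v) (I.cls w)"
      unfolding U by (rule I.star_primitive[OF primitive bilinear T_one_left]) (simp_all add: I.carrier_Q)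
    then show ?thesis unfolding T_v by (simp add: v I.ops_Q algebra_simps)
  qed
  have "exp_series (star_algebra U \<Delta> T) (\<iota> v) n
      = I.cls (scalar_mult (1 / fact n) (((\<lambda>w. ?a * w + w * ?b) ^^ n) 1))"
    by (rule exp_series_cls[OF free_algebra_quotient_uea _ _ star])
      (simp_all add: star_algebra_def U)
  then show "exp_series (star_algebra U \<Delta> T) (\<iota> v) n
      = series_mult U (exp_series U (\<iota> (pi_minus v))) (exp_series U (\<iota> (pi_plus v))) n"
    unfolding U \<iota> by (simp only: exp_series_mult_eq[OF free_algebra_quotient_uea])
qed

end
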